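(* Let $f:\mathbb{R}^d\to\mathbb{R}$ be $\mu$-strongly convex with $\mu>0$, twice continuously differentiable, with $L_{\mathbf H}$-Lipschitz Hessian. Let $\mathbf{x}_0\in\mathbb{R}^d$, let $H_0>0$ satisfy $\|\nabla^2 f(\mathbf{x})\|\le H_0$ for all $\mathbf{x}$ with $f(\mathbf{x})\le f(\mathbf{x}_0)$, and put $\kappa=H_0/\mu$. Run FNCR-LS (see context) from $\mathbf{x}_0$ with $\mathbf{H}_k=\nabla^2 f(\mathbf{x}_k)$, where at outer iteration $k$ the inner parameters satisfy $\omega\le\|\mathbf{g}_k\|$ and $T\ge\lceil\sqrt{\kappa}\,\ln(2\|\mathbf{g}_k\|^{-1})/4\rceil$. Then FNCR-LS achieves superlinear convergence in terms of iteration complexity.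
   Context: $\|\cdot\|$ is the Euclidean/spectral norm; $\mathbf{g}_k=\nabla f(\mathbf{x}_k)$. $f$ is $\mu$-strongly convex if $f(\mathbf{y})\ge f(\mathbf{x})+\langle\nabla f(\mathbf{x}),\mathbf{y}-\mathbf{x}\rangle+\frac{\mu}{2}\|\mathbf{y}-\mathbf{x}\|^2$ for all $\mathbf{x},\mathbf{y}$. $L_{\mathbf H}$-Lipschitz Hessian ($0\le L_{\mathbf H}<\infty$): $\|\nabla^2f(\mathbf{x})-\nabla^2f(\mathbf{y})\|\le L_{\mathbf H}\|\mathbf{x}-\mathbf{y}\|$ for all $\mathbf{x},\mathbf{y}$. Convergence refers to the decay of $\delta_k=f(\mathbf{x}_k)-\min f$ in the outer iteration counter $k$; iteration complexity counts outer iterations. Sufficiency: at a point $\mathbf{x}$, a vector $\mathbf{d}$ is $c$-sufficient if $f(\mathbf{x}+\mathbf{d})\le f(\mathbf{x})+c\langle\nabla f(\mathbf{x}),\mathbf{d}\rangle$. Conjugate residual (CR) recursion for $(\mathbf{H},\mathbf{g})$, $\mathbf{H}\succ0$: $\mathbf{s}^{(0)}=\mathbf{0}$, $\mathbf{r}^{(0)}=\mathbf{p}^{(0)}=-\mathbf{g}$; $\alpha^{(t)}=\langle\mathbf{r}^{(t)},\mathbf{H}\mathbf{r}^{(t)}\rangle/\|\mathbf{H}\mathbf{p}^{(t)}\|^2$, $\mathbf{s}^{(t+1)}=\mathbf{s}^{(t)}+\alpha^{(t)}\mathbf{p}^{(t)}$, $\mathbf{r}^{(t+1)}=\mathbf{r}^{(t)}-\alpha^{(t)}\mathbf{H}\mathbf{p}^{(t)}$,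 $\gamma^{(t)}=\langle\mathbf{r}^{(t+1)},\mathbf{H}\mathbf{r}^{(t+1)}\rangle/\langle\mathbf{r}^{(t)},\mathbf{H}\mathbf{r}^{(t)}\rangle$, $\mathbf{p}^{(t+1)}=\mathbf{r}^{(t+1)}+\gamma^{(t)}\mathbf{p}^{(t)}$. Inner solver, at $\mathbf{x}$ with $\mathbf{g}=\nabla f(\mathbf{x})$ and matrix $\mathbf{H}$; parameters: integers $1\le T\le T_{\max}\le d$, $0<\rho<1/2$, $0\le\omega<1$. Let $\rho_0=\rho$, $\rho_t=\rho\|\mathbf{g}\|^2/\|\mathbf{r}^{(t-1)}\|^2$ for $t\ge1$. Start with $t=0$ and loop: if $t\ge T$ and $\mathbf{s}^{(t)}$ is not $\rho_t$-sufficient, exit the loop; otherwise, if $\|\mathbf{r}^{(t)}\|\le\omega\|\mathbf{g}\|$ or $t=T_{\max}$, return $\mathbf{s}^{(t)}$ (type TER); otherwise perform one CR step and set $t\leftarrow t+1$. After exiting the loop: if $t=T$ return $\mathbf{s}^{(t)}$ (type INS), else return $\mathbf{s}^{(t-1)}$ (type SUF). Backtracking with parameters $0<\rho<1/2$ (the same $\rho$) and $0<\zeta<1$: given $\mathbf{s}$, return $\eta\mathbf{s}$ with $\eta=\zeta^j$, $j\ge0$ the smallest integer such that $\zeta^j\mathbf{s}$ is $\rho$-sufficient. FNCR-LS: from $\mathbf{x}_0$, for $k=0,1,2,\dots$ (while $\mathbf{g}_k\neq\mathbf 0$): $\mathbf{s}_k$ is the output of the inner solver at $\mathbf{x}_k$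 with $(\mathbf{H}_k,\mathbf{g}_k)$ (the parameters $T,T_{\max},\omega$ may vary with $k$); $\mathbf{d}_k=\eta\mathbf{s}_k$ is the output of backtracking at $\mathbf{x}_k$; $\mathbf{x}_{k+1}=\mathbf{x}_k+\mathbf{d}_k$. *)

theory Defs
  imports "HOL-Analysis.Analysis" "HOL-Library.Landau_Symbols"
begin

(* The library norm on real^'n^'n is the Frobenius norm, hence the explicit operator norm. *)
definition spectral_norm :: "real^'n^'n \<Rightarrow> real" where
  "spectral_norm A = onorm (\<lambda>v. A *v v)"

(* g plays the role of the gradient of f. *)
definition strongly_convex ::
  "real \<Rightarrow> (real^'n \<Rightarrow> real) \<Rightarrow> (real^'n \<Rightarrow> real^'n) \<Rightarrow> bool" where
  "strongly_convex \<mu> f g \<longleftrightarrow>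
     (\<forall>x y. f y \<ge> f x + g x \<bullet> (y - x) + \<mu> / 2 * (norm (y - x))\<^sup>2)"

(* g and H are the gradient and the Hessian of f. *)
definition twice_cont_differentiable ::
  "(real^'n \<Rightarrow> real) \<Rightarrow> (real^'n \<Rightarrow> real^'n) \<Rightarrow> (real^'n \<Rightarrow> real^'n^'n) \<Rightarrow> bool" where
  "twice_cont_differentiable f g H \<longleftrightarrow>
     (\<forall>x. GDERIV f x :> g x) \<and>
     (\<forall>x. (g has_derivative (\<lambda>v. H x *v v)) (at x)) \<and>
     continuous_on UNIV H"

definition lipschitz_hessian :: "real \<Rightarrow> (real^'n \<Rightarrow> real^'n^'n) \<Rightarrow> bool" where
  "lipschitz_hessian L H \<longleftrightarrow>
     0 \<le> L \<and> (\<forall>x y. spectral_norm (H x - H y) \<le> L * norm (x - y))"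

(* The vector d is c-sufficient at x, where gx is the gradient of f at x. *)
definition sufficient ::
  "(real^'n \<Rightarrow> real) \<Rightarrow> real^'n \<Rightarrow> real^'n \<Rightarrow> real \<Rightarrow> real^'n \<Rightarrow> bool" where
  "sufficient f x gx c d \<longleftrightarrow> f (x + d) \<le> f x + c * (gx \<bullet> d)"

(* Conjugate residual recursion; the state is the triple (s, r, p). *)
primrec cr :: "real^'n^'n \<Rightarrow> real^'n \<Rightarrow> nat \<Rightarrow> (real^'n) \<times> (real^'n) \<times> (real^'n)" where
  "cr H g 0 = (0, - g, - g)"
| "cr H g (Suc t) =
     (let (s, r, p) = cr H g t;
          \<alpha> = (r \<bullet> (H *v r)) / (norm (H *v p))\<^sup>2;
          r' = r - \<alpha> *\<^sub>R (H *v p);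
          \<gamma> = (r' \<bullet> (H *v r')) / (r \<bullet> (H *v r))
      in (s + \<alpha> *\<^sub>R p, r', r' + \<gamma> *\<^sub>R p))"

definition cr_s :: "real^'n^'n \<Rightarrow> real^'n \<Rightarrow> nat \<Rightarrow> real^'n" where
  "cr_s H g t = fst (cr H g t)"

definition cr_r :: "real^'n^'n \<Rightarrow> real^'n \<Rightarrow> nat \<Rightarrow> real^'n" where
  "cr_r H g t = fst (snd (cr H g t))"

definition rho_at :: "real \<Rightarrow> real^'n^'n \<Rightarrow> real^'n \<Rightarrow> nat \<Rightarrow> real" where
  "rho_at \<rho> H g t =
     (if t = 0 then \<rho> else \<rho> * (norm g)\<^sup>2 / (norm (cr_r H g (t - 1)))\<^sup>2)"

(* The loop of the inner solver, entered with counter t; the three return branches have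
   the types INS, SUF and TER, in this order.  The loop starts at t = 0 and increments t
   by one, so Tmax \<le> t holds for the first time exactly when t = Tmax. *)
function inner_loop ::
  "(real^'n \<Rightarrow> real) \<Rightarrow> real^'n \<Rightarrow> real^'n \<Rightarrow> real^'n^'n \<Rightarrow>
   real \<Rightarrow> real \<Rightarrow> nat \<Rightarrow> nat \<Rightarrow> nat \<Rightarrow> real^'n" where
  "inner_loop f x gx H \<rho> \<omega> T Tmax t =
     (if T \<le> t \<and> \<not> sufficient f x gx (rho_at \<rho> H gx t) (cr_s H gx t)
      then (if t = T then cr_s H gx t else cr_s H gx (t - 1))
      else if norm (cr_r H gx t) \<le> \<omega> * norm gx \<or> Tmax \<le> t then cr_s H gx t
      else inner_loop f x gx H \<rho> \<omega> T Tmax (Suc t))"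
  by pat_completeness auto
termination
  by (relation "Wellfounded.measure (\<lambda>(f, x, gx, H, \<rho>, \<omega>, T, Tmax, t). Tmax - t)") auto

declare inner_loop.simps [simp del]

definition inner_solver ::
  "(real^'n \<Rightarrow> real) \<Rightarrow> real^'n \<Rightarrow> real^'n \<Rightarrow> real^'n^'n \<Rightarrow>
   real \<Rightarrow> real \<Rightarrow> nat \<Rightarrow> nat \<Rightarrow> real^'n" where
  "inner_solver f x gx H \<rho> \<omega> T Tmax = inner_loop f x gx H \<rho> \<omega> T Tmax 0"

(* Should no exponent be sufficient, LEAST is an unspecified number and nothing is known
   about the step. *)
definition backtracking ::
  "(real^'n \<Rightarrow> real) \<Rightarrow> real^'n \<Rightarrow> real^'n \<Rightarrow> real \<Rightarrow> real \<Rightarrow> real^'n \<Rightarrow> real^'n" where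
  "backtracking f x gx \<rho> \<zeta> s =
     \<zeta> ^ (LEAST j. sufficient f x gx \<rho> (\<zeta> ^ j *\<^sub>R s)) *\<^sub>R s"

(* The iterates of FNCR-LS started at x0.  T, Tmax and \<omega> are the parameters of the single
   outer iterations.  A run that stops because the gradient vanishes is represented by the
   sequence that stays constant from there on. *)
definition fncr_ls_run ::
  "(real^'n \<Rightarrow> real) \<Rightarrow> (real^'n \<Rightarrow> real^'n) \<Rightarrow> (real^'n \<Rightarrow> real^'n^'n) \<Rightarrow>
   real \<Rightarrow> real \<Rightarrow> (nat \<Rightarrow> real) \<Rightarrow> (nat \<Rightarrow> nat) \<Rightarrow> (nat \<Rightarrow> nat) \<Rightarrow>
   real^'n \<Rightarrow> (nat \<Rightarrow> real^'n) \<Rightarrow> bool" where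
  "fncr_ls_run f g H \<rho> \<zeta> \<omega> T Tmax x0 x \<longleftrightarrow>
     x 0 = x0 \<and>
     (\<forall>k. x (Suc k) =
        (if g (x k) = 0 then x k
         else x k + backtracking f (x k) (g (x k)) \<rho> \<zeta>
                (inner_solver f (x k) (g (x k)) (H (x k)) \<rho> (\<omega> k) (T k) (Tmax k))))"

(* Q-superlinear convergence to 0.  The little-o form is that the ratio of consecutive terms
   tends to 0, and it also makes sense for a sequence that reaches 0 and stays there. *)
definition converges_superlinearly :: "(nat \<Rightarrow> real) \<Rightarrow> bool" where
  "converges_superlinearly \<delta> \<longleftrightarrow> \<delta> \<longlonglongrightarrow> 0 \<and> (\<lambda>k. \<delta> (Suc k)) \<in> o(\<delta>)"

end

theory Submission
  imports Defs
begin

text \<open>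
  As the dimension \<open>d\<close> is fixed and the gradients tend to 0, the lower bound on \<open>T\<close> eventually
  forces \<open>T = Tmax = d\<close>. In exact arithmetic CR terminates within \<open>d\<close> steps, so from then on the
  residual of the inner solution is at most \<open>\<omega> \<parallel>g\<parallel> \<le> \<parallel>g\<parallel>\<^sup>2\<close>. Such an inexact Newton step is
  \<open>\<rho>\<close>-sufficient near the minimizer, so backtracking keeps it, and the optimality gap is
  squared up to a constant.

  That the gradients tend to 0 holds for any admissible inner parameters: every CR iterate other
  than \<open>cr_s H g 0\<close> satisfies \<open>- \<langle>g, s\<rangle> \<ge> (\<mu> / H0\<^sup>2) \<parallel>g\<parallel>\<^sup>2\<close> and \<open>\<parallel>s\<parallel> \<le> (2 / \<mu>) \<parallel>g\<parallel>\<close>, hence the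
  backtracking factors are bounded below on the initial sublevel set and the gap decreases
  geometrically.
\<close>

subsection \<open>Conjugate residuals\<close>

definition cr_p :: "real^'n^'n \<Rightarrow> real^'n \<Rightarrow> nat \<Rightarrow> real^'n" where
  "cr_p H g t = snd (snd (cr H g t))"

definition cr_alpha :: "real^'n^'n \<Rightarrow> real^'n \<Rightarrow> nat \<Rightarrow> real" where
  "cr_alpha H g t = (cr_r H g t \<bullet> (H *v cr_r H g t)) / (norm (H *v cr_p H g t))\<^sup>2"

definition cr_gamma :: "real^'n^'n \<Rightarrow> real^'n \<Rightarrow> nat \<Rightarrow> real" where
  "cr_gamma H g t =
     (cr_r H g (Suc t) \<bullet> (H *v cr_r H g (Suc t))) / (cr_r H g t \<bullet> (H *v cr_r H g t))"

lemma cr_0 [simp]: "cr_s H g 0 = 0" "cr_r H g 0 = - g" "cr_p H g 0 = - g"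
  by (simp_all add: cr_s_def cr_r_def cr_p_def)

lemma cr_s_Suc: "cr_s H g (Suc t) = cr_s H g t + cr_alpha H g t *\<^sub>R cr_p H g t"
  and cr_r_Suc: "cr_r H g (Suc t) = cr_r H g t - cr_alpha H g t *\<^sub>R (H *v cr_p H g t)"
  and cr_p_Suc: "cr_p H g (Suc t) = cr_r H g (Suc t) + cr_gamma H g t *\<^sub>R cr_p H g t"
  by (simp_all add: cr_s_def cr_r_def cr_p_def cr_alpha_def cr_gamma_def Let_def split_beta)

lemma cr_residual: "cr_r H g t = - g - H *v cr_s H g t"
  by (induction t)
    (simp_all add: cr_s_Suc cr_r_Suc matrix_vector_right_distrib matrix_vector_mult_scaleR)

locale spd_matrix =
  fixes A :: "real^'n^'n"
  assumes symmetric: "u \<bullet> (A *v v) = v \<bullet> (A *v u)"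
    and positive: "v \<noteq> 0 \<Longrightarrow> 0 < v \<bullet> (A *v v)"
begin

lemma nonneg: "0 \<le> v \<bullet> (A *v v)"
  using positive[of v] by (cases "v = 0") auto

lemma mat_vec_eq_0_iff: "A *v v = 0 \<longleftrightarrow> v = 0"
  using positive[of v] by (cases "v = 0") auto

lemma cr_alpha_nonneg: "0 \<le> cr_alpha A g t"
  and cr_gamma_nonneg: "0 \<le> cr_gamma A g t"
  by (simp_all add: cr_alpha_def cr_gamma_def nonneg)

lemma cr_p_eq_0: "cr_r A g t = 0 \<Longrightarrow> cr_p A g t = 0"
  by (cases t) (simp_all add: cr_p_Suc cr_gamma_def)

text \<open>Either the numerator vanishes, so the residual and with it the direction are 0, or, by
  \<open>x / 0 = 0\<close>, the denominator vanishes and definiteness applies. It allows division by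
  \<open>cr_alpha\<close> along nonzero directions.\<close>

lemma cr_alpha_eq_0: "cr_alpha A g t = 0 \<Longrightarrow> cr_p A g t = 0"
  using positive[of "cr_r A g t"] cr_p_eq_0[of g t] mat_vec_eq_0_iff[of "cr_p A g t"]
  by (cases "cr_r A g t = 0") (auto simp: cr_alpha_def)

lemma cr_r_stays_0:
  assumes "cr_r A g t = 0" "t \<le> u"
  shows "cr_r A g u = 0"
  using assms(2,1) by (induction rule: dec_induct) (simp_all add: cr_r_Suc cr_alpha_def)

text \<open>Both relations are carried through one induction: \<open>cr_alpha\<close> makes the new
  residual orthogonal to the latest \<open>A *v cr_p A g n\<close>, \<open>cr_gamma\<close> does the
  same for the new \<open>A *v cr_p\<close>, and older indices rest on the induction
  hypothesis.\<close>

lemma cr_conjugacy: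
  assumes "i < n"
  shows "cr_r A g n \<bullet> (A *v cr_p A g i) = 0"
    and "(A *v cr_p A g n) \<bullet> (A *v cr_p A g i) = 0"
proof -
  have "cr_r A g n \<bullet> (A *v cr_p A g i) = 0 \<and> (A *v cr_p A g n) \<bullet> (A *v cr_p A g i) = 0"
    using assms
  proof (induction n arbitrary: i)
    case (Suc n)
    let ?r = "cr_r A g" and ?p = "cr_p A g" and ?al = "cr_alpha A g" and ?ga = "cr_gamma A g"
    have rp: "?r n \<bullet> (A *v ?p n) = ?r n \<bullet> (A *v ?r n)"
    proof (cases n)
      case (Suc m)
      then show ?thesis
        using Suc.IH[of m]
        by (simp add: cr_p_Suc[of _ _ m] matrix_vector_right_distrib matrix_vector_mult_scaleR
            inner_add_right)
    qed simp
    have r_Suc: "?r (Suc n) \<bullet> (A *v ?p i) = 0" if "i \<le> n" for i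
    proof (cases "i = n")
      case True
      show ?thesis
      proof (cases "A *v ?p n = 0")
        case False
        then have "?al n * ((A *v ?p n) \<bullet> (A *v ?p n)) = ?r n \<bullet> (A *v ?r n)"
          by (simp add: cr_alpha_def power2_norm_eq_inner)
        then show ?thesis
          using True rp by (simp add: cr_r_Suc inner_diff_left)
      qed (simp add: True)
    next
      case False
      then show ?thesis
        using that Suc.IH[of i] by (simp add: cr_r_Suc inner_diff_left)
    qed
    \<comment> \<open>Each residual is its direction minus a multiple of the preceding one, so
      conjugacy passes from directions to residuals.\<close>
    have rr: "?r (Suc n) \<bullet> (A *v ?r i) = 0" if "i \<le> n" for i
    proof (cases i)
      case 0
      then show ?thesis using r_Suc[of 0] by simp
    next
      case (Suc m)
      then show ?thesis
        using r_Suc[of m] r_Suc[of i] that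
        by (simp add: cr_p_Suc[of _ _ m] matrix_vector_right_distrib matrix_vector_mult_scaleR
            inner_add_right)
    qed
    have i: "i \<le> n" using Suc.prems by simp
    have "(A *v ?p (Suc n)) \<bullet> (A *v ?p i) = 0"
    proof (cases "?p i = 0")
      case False
      \<comment> \<open>With \<open>?al i\<close> nonzero, \<open>A *v ?p i\<close> is a multiple of
        a difference of consecutive residuals, which reduces the claim to \<open>rr\<close>.\<close>
      have al: "?al i \<noteq> 0" using False cr_alpha_eq_0 by blast
      have Ap: "A *v ?p i \<noteq> 0" using False mat_vec_eq_0_iff by simp
      have "?al i * ((A *v ?r (Suc n)) \<bullet> (A *v ?p i)) = (A *v ?r (Suc n)) \<bullet> (?r i - ?r (Suc i))"
        by (simp add: cr_r_Suc)
      also have "\<dots> = ?r (Suc n) \<bullet> (A *v ?r i) - ?r (Suc n) \<bullet> (A *v ?r (Suc i))"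
        by (simp only: inner_diff_right inner_commute[of "A *v _"] symmetric[of "?r (Suc n)"])
      also have "\<dots> = - (?r (Suc n) \<bullet> (A *v ?r (Suc i)))"
        using rr[OF i] by simp
      finally have *: "?al i * ((A *v ?r (Suc n)) \<bullet> (A *v ?p i))
          = - (?r (Suc n) \<bullet> (A *v ?r (Suc i)))" .
      show ?thesis
      proof (cases "i = n")
        case True
        \<comment> \<open>The denominators of \<open>?al n\<close> and \<open>?ga n\<close> cancel,
          leaving exactly the term that offsets the right side of \<open>*\<close>.\<close>
        have "?al n * (?ga n * ((A *v ?p n) \<bullet> (A *v ?p n))) = ?r (Suc n) \<bullet> (A *v ?r (Suc n))"
          using al Ap True by (auto simp: cr_alpha_def cr_gamma_def power2_norm_eq_inner)
        then have "?al n * ((A *v ?p (Suc n)) \<bullet> (A *v ?p n)) = 0"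
          using * True
          by (simp add: cr_p_Suc matrix_vector_right_distrib matrix_vector_mult_scaleR
              inner_add_left distrib_left)
        then show ?thesis using al True by simp
      next
        case False
        then have "(A *v ?r (Suc n)) \<bullet> (A *v ?p i) = 0"
          using * rr[of "Suc i"] i al by simp
        then show ?thesis
          using Suc.IH[of i] False i
          by (simp add: cr_p_Suc matrix_vector_right_distrib matrix_vector_mult_scaleR inner_add_left)
      qed
    qed simp
    then show ?case using r_Suc[OF i] by simp
  qed simp
  then show "cr_r A g n \<bullet> (A *v cr_p A g i) = 0"
    and "(A *v cr_p A g n) \<bullet> (A *v cr_p A g i) = 0"
    by simp_all
qed

lemma cr_r_p: "cr_r A g n \<bullet> (A *v cr_p A g n) = cr_r A g n \<bullet> (A *v cr_r A g n)"
proof (cases n)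
  case (Suc m)
  then show ?thesis
    using cr_conjugacy(1)[of m n g]
    by (simp add: cr_p_Suc[of _ _ m] matrix_vector_right_distrib matrix_vector_mult_scaleR
        inner_add_right)
qed simp

lemma cr_r_conjugate:
  assumes "i < n"
  shows "cr_r A g n \<bullet> (A *v cr_r A g i) = 0"
proof (cases i)
  case 0
  then show ?thesis using cr_conjugacy(1)[of 0 n g] assms by simp
next
  case (Suc m)
  then show ?thesis
    using cr_conjugacy(1)[of m n g] cr_conjugacy(1)[of i n g] assms
    by (simp add: cr_p_Suc[of _ _ m] matrix_vector_right_distrib matrix_vector_mult_scaleR
        inner_add_right)
qed

text \<open>Conjugacy gives 0 off the diagonal, positivity the sign on it.\<close>

lemma cr_r_r_nonneg: "0 \<le> cr_r A g i \<bullet> (A *v cr_r A g j)"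
  using cr_r_conjugate[of i j g] cr_r_conjugate[of j i g] nonneg[of "cr_r A g i"]
    symmetric[of "cr_r A g i" "cr_r A g j"]
  by (metis linorder_neqE_nat order_refl)

text \<open>As every \<open>cr_gamma\<close> is nonnegative, directions are nonnegative combinations
  of residuals and inherit the sign.\<close>

lemma cr_p_r_nonneg: "0 \<le> cr_p A g i \<bullet> (A *v cr_r A g j)"
proof (induction i)
  case 0
  then show ?case using cr_r_r_nonneg[of g 0 j] by simp
next
  case (Suc i)
  then show ?case
    using cr_r_r_nonneg[of g "Suc i" j] cr_gamma_nonneg[of g i]
    by (simp add: cr_p_Suc inner_add_left)
qed

lemma cr_p_p_nonneg: "0 \<le> cr_p A g i \<bullet> (A *v cr_p A g j)"
proof (induction j)
  case 0
  then show ?case using cr_p_r_nonneg[of g i 0] by simp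
next
  case (Suc j)
  then show ?case
    using cr_p_r_nonneg[of g i "Suc j"] cr_gamma_nonneg[of g j]
    by (simp add: cr_p_Suc[of _ _ j] matrix_vector_right_distrib matrix_vector_mult_scaleR
        inner_add_right)
qed

text \<open>The vectors \<open>A *v cr_p A g i\<close> are orthogonal, and nonzero as long as the residuals are.\<close>
lemma cr_terminates:
  assumes "CARD('n) \<le> t"
  shows "cr_r A g t = 0"
proof (rule ccontr)
  assume "cr_r A g t \<noteq> 0"
  then have r: "cr_r A g i \<noteq> 0" if "i \<le> CARD('n)" for i
    using cr_r_stays_0 that assms le_trans by blast
  let ?q = "\<lambda>i. A *v cr_p A g i"
  \<comment> \<open>These are \<open>d + 1\<close> indices, one too many for independent
    vectors.\<close>
  let ?I = "{..CARD('n)}"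
  have nz: "?q i \<noteq> 0" if "i \<in> ?I" for i
    using cr_r_p[of g i] positive[OF r[of i]] that by auto
  have orth: "?q i \<bullet> ?q j = 0" if "i \<noteq> j" for i j
    using that cr_conjugacy(2)[of i j g] cr_conjugacy(2)[of j i g]
    by (metis inner_commute linorder_neqE_nat)
  have "inj_on ?q ?I"
    using nz orth by (intro inj_onI) (metis inner_eq_zero_iff)
  moreover have "independent (?q ` ?I)"
    using nz orth
    by (intro pairwise_orthogonal_independent pairwise_imageI) (auto simp: orthogonal_def)
  ultimately have "card ?I \<le> DIM(real^'n)"
    using independent_card_le[of "?q ` ?I"] by (simp add: card_image)
  then show False by simp
qed

text \<open>Since the recursion terminates, \<open>- g\<close> telescopes into a nonnegative combination of
  the vectors \<open>A *v cr_p A g j\<close>.\<close>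
lemma cr_g_p_nonneg: "0 \<le> - g \<bullet> cr_p A g i"
proof -
  have "0 \<le> (- g - cr_r A g n) \<bullet> cr_p A g i" for n
  proof (induction n)
    case (Suc n)
    have "0 \<le> cr_alpha A g n * ((A *v cr_p A g n) \<bullet> cr_p A g i)"
      using cr_alpha_nonneg[of g n] cr_p_p_nonneg[of g i n]
      by (metis inner_commute mult_nonneg_nonneg)
    then show ?case using Suc by (simp add: cr_r_Suc inner_diff_left)
  qed simp
  from this[of "CARD('n)"] show ?thesis by (simp add: cr_terminates)
qed

text \<open>The first step, along \<open>- g\<close>, contributes the left side; later steps only
  add nonnegative terms by \<open>cr_g_p_nonneg\<close>.\<close>

lemma cr_descent:
  assumes "1 \<le> t"
  shows "cr_alpha A g 0 * (norm g)\<^sup>2 \<le> - g \<bullet> cr_s A g t"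
  using assms
proof (induction t rule: dec_induct)
  case base
  show ?case
    by (simp add: cr_s_Suc[of _ _ 0, simplified] power2_norm_eq_inner)
next
  case (step t)
  have "0 \<le> cr_alpha A g t * (- g \<bullet> cr_p A g t)"
    using cr_alpha_nonneg cr_g_p_nonneg by (rule mult_nonneg_nonneg)
  then show ?case using step.IH by (simp add: cr_s_Suc inner_add_right)
qed

text \<open>By \<open>cr_r_p\<close>, \<open>cr_alpha\<close> is the coefficient of the orthogonal
  projection of the residual onto \<open>A *v cr_p A g t\<close>; removing a projection cannot
  increase the norm.\<close>

lemma norm_cr_r_le: "norm (cr_r A g t) \<le> norm g"
proof (induction t)
  case (Suc t)
  let ?r = "cr_r A g t" and ?q = "A *v cr_p A g t"
  have "?r \<bullet> ?q = cr_alpha A g t * (?q \<bullet> ?q)"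
    using cr_r_p[of g t] by (cases "?q = 0") (simp_all add: cr_alpha_def power2_norm_eq_inner)
  moreover have "(norm (u - c *\<^sub>R v))\<^sup>2 = (norm u)\<^sup>2 - 2 * c * (u \<bullet> v) + c\<^sup>2 * (v \<bullet> v)"
    for u v :: "real^'n" and c
    unfolding power2_norm_eq_inner
    by (simp add: inner_diff_left inner_diff_right inner_commute[of v u] power2_eq_square[of c]
        algebra_simps)
  ultimately have "(norm (cr_r A g (Suc t)))\<^sup>2 = (norm ?r)\<^sup>2 - (cr_alpha A g t)\<^sup>2 * (?q \<bullet> ?q)"
    by (simp add: cr_r_Suc power2_eq_square)
  also have "\<dots> \<le> (norm ?r)\<^sup>2" by simp
  finally have "norm (cr_r A g (Suc t)) \<le> norm ?r" by (simp add: power2_le_iff_abs_le)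
  then show ?case using Suc by simp
qed simp

end

text \<open>Two facts hold for all three return types: the zero iterate is never returned, and for
  \<open>T = Tmax\<close> the sufficiency test cannot stop the loop before
  \<open>Tmax\<close>.\<close>

lemma inner_loop_result:
  assumes "T \<le> Tmax" "1 \<le> T" "\<omega> < 1" "gx \<noteq> 0" "t \<le> Tmax"
  shows "\<exists>t'\<ge>1. inner_loop f x gx H \<rho> \<omega> T Tmax t = cr_s H gx t' \<and>
    (T = Tmax \<longrightarrow> t' = Tmax \<or> norm (cr_r H gx t') \<le> \<omega> * norm gx)"
  using assms
proof (induction "Tmax - t" arbitrary: t rule: less_induct)
  case less
  let ?fails = "T \<le> t \<and> \<not> sufficient f x gx (rho_at \<rho> H gx t) (cr_s H gx t)"
  let ?stop = "norm (cr_r H gx t) \<le> \<omega> * norm gx \<or> Tmax \<le> t"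
  consider "?fails" "t = T" | "?fails" "t \<noteq> T" | "\<not> ?fails" "?stop" | "\<not> ?fails" "\<not> ?stop"
    by blast
  then show ?case
  proof cases
    case 1
    then have "inner_loop f x gx H \<rho> \<omega> T Tmax t = cr_s H gx t"
      by (subst inner_loop.simps) simp
    then show ?thesis using 1 less.prems by auto
  next
    case 2
    then have "inner_loop f x gx H \<rho> \<omega> T Tmax t = cr_s H gx (t - 1)"
      by (subst inner_loop.simps) simp
    \<comment> \<open>Here \<open>T < t\<close>, so \<open>t - 1 \<ge> T \<ge> 1\<close>; for
      \<open>T = Tmax\<close> the case is void.\<close>
    then show ?thesis using 2 less.prems by (intro exI[of _ "t - 1"]) auto
  next
    case 3
    then have "inner_loop f x gx H \<rho> \<omega> T Tmax t = cr_s H gx t"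
      by (subst inner_loop.simps) auto
    \<comment> \<open>At \<open>t = 0\<close> the residual is \<open>- gx\<close>, which fails the
      residual test as \<open>\<omega> < 1\<close>, and \<open>Tmax \<ge> 1\<close>.\<close>
    moreover have "1 \<le> t" using 3 less.prems by (cases t) auto
    ultimately show ?thesis using 3 less.prems by (intro exI[of _ t]) auto
  next
    case 4
    then have "inner_loop f x gx H \<rho> \<omega> T Tmax t = inner_loop f x gx H \<rho> \<omega> T Tmax (Suc t)"
      by (subst inner_loop.simps) auto
    then show ?thesis using 4 less.prems less.hyps[of "Suc t"] by auto
  qed
qed

subsection \<open>Taylor bounds from a Lipschitz Hessian\<close>

lemma norm_mult_le_spectral: "norm (M *v v) \<le> spectral_norm M * norm v"
  for M :: "real^'n^'n"
  unfolding spectral_norm_def by (rule onorm) (rule matrix_vector_mul_bounded_linear)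

text \<open>Serves as the limit \<open>t \<rightarrow> 0\<close> in Taylor estimates divided by
  \<open>t^2\<close>.\<close>

lemma le_of_le_add_small:
  fixes a b c :: real
  assumes "\<And>t. 0 < t \<Longrightarrow> a \<le> b + c * t"
  shows "a \<le> b"
proof (rule field_le_epsilon)
  fix e :: real assume "0 < e"
  define t where "t = e / (\<bar>c\<bar> + 1)"
  have "0 < t" using \<open>0 < e\<close> by (simp add: t_def)
  moreover have "c * t \<le> e"
  proof -
    have "c * t \<le> (\<bar>c\<bar> + 1) * t" using \<open>0 < t\<close> by (intro mult_right_mono) auto
    also have "\<dots> = e" by (simp add: t_def)
    finally show ?thesis .
  qed
  ultimately show "a \<le> b + e" using assms[of t] by linarith
qed

locale lipschitz_hessian_fun =
  fixes f :: "real^'n \<Rightarrow> real"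
    and g :: "real^'n \<Rightarrow> real^'n"
    and H :: "real^'n \<Rightarrow> real^'n^'n"
    and L :: real
  assumes smooth: "twice_cont_differentiable f g H"
    and lipschitz: "lipschitz_hessian L H"
begin

lemma L_nonneg: "0 \<le> L"
  using lipschitz by (simp add: lipschitz_hessian_def)

lemma hessian_lipschitz: "norm (H x *v v - H y *v v) \<le> L * norm (x - y) * norm v"
proof -
  have "norm ((H x - H y) *v v) \<le> spectral_norm (H x - H y) * norm v"
    by (rule norm_mult_le_spectral)
  also have "\<dots> \<le> L * norm (x - y) * norm v"
    using lipschitz by (intro mult_right_mono) (auto simp: lipschitz_hessian_def)
  finally show ?thesis by (simp add: matrix_vector_mult_diff_rdistrib)
qed

text \<open>Mean value inequality for \<open>?h\<close>, whose derivative \<open>H y - H x\<close>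
  is bounded by \<open>L * norm d\<close> on the segment. The constant \<open>L\<close> in place of
  \<open>L / 2\<close> suffices.\<close>

lemma gradient_taylor: "norm (g (x + d) - g x - H x *v d) \<le> L * (norm d)\<^sup>2"
proof -
  let ?S = "closed_segment x (x + d)" and ?h = "\<lambda>y. g y - H x *v y"
  have "norm (?h (x + d) - ?h x) \<le> L * norm d * norm (x + d - x)"
  proof (rule differentiable_bound[of ?S])
    fix y assume y: "y \<in> ?S"
    have "(g has_derivative (\<lambda>v. H y *v v)) (at y)"
      using smooth by (simp add: twice_cont_differentiable_def)
    moreover have "((*v) (H x) has_derivative (*v) (H x)) (at y)"
      by (intro bounded_linear_imp_has_derivative matrix_vector_mul_bounded_linear)
    ultimately show "(?h has_derivative (\<lambda>v. H y *v v - H x *v v)) (at y within ?S)"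
      by (intro has_derivative_at_withinI[OF has_derivative_diff])
    have "norm (y - x) \<le> norm d"
      using segment_bound1[OF y] by (simp add: norm_minus_commute)
    then have "L * norm (y - x) \<le> L * norm d"
      using L_nonneg by (rule mult_left_mono)
    then have "norm (H y *v v - H x *v v) \<le> L * norm d * norm v" for v
      using hessian_lipschitz[of y v x] mult_right_mono[of _ _ "norm v"]
      by (meson norm_ge_zero order_trans)
    then show "onorm (\<lambda>v. H y *v v - H x *v v) \<le> L * norm d"
      using L_nonneg by (intro onorm_bound) auto
  qed auto
  then show ?thesis
    by (simp add: matrix_vector_right_distrib power2_eq_square algebra_simps)
qed

text \<open>The mean value theorem for the remainder \<open>?\<phi>\<close> along the segment; its
  derivative is controlled by \<open>gradient_taylor\<close>.\<close>

lemma function_taylor: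
  "\<bar>f (x + d) - f x - g x \<bullet> d - d \<bullet> (H x *v d) / 2\<bar> \<le> L * norm d ^ 3"
proof -
  let ?q = "d \<bullet> (H x *v d)"
  let ?\<phi> = "\<lambda>t. f (x + t *\<^sub>R d) - t * (g x \<bullet> d) - t\<^sup>2 / 2 * ?q"
  let ?\<phi>' = "\<lambda>t. g (x + t *\<^sub>R d) \<bullet> d - g x \<bullet> d - t * ?q"
  have deriv: "(?\<phi> has_real_derivative ?\<phi>' t) (at t)" for t
  proof -
    have f': "(f has_derivative (\<lambda>v. v \<bullet> g (x + t *\<^sub>R d))) (at (x + t *\<^sub>R d))"
      using smooth by (simp add: twice_cont_differentiable_def gderiv_def)
    have "((\<lambda>t. x + t *\<^sub>R d) has_derivative (\<lambda>s. s *\<^sub>R d)) (at t)"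
      by (auto intro!: derivative_eq_intros)
    from has_derivative_compose[OF this f']
    have "((\<lambda>t. f (x + t *\<^sub>R d)) has_real_derivative g (x + t *\<^sub>R d) \<bullet> d) (at t)"
      by (simp add: has_field_derivative_def inner_commute mult_commute_abs)
    then show ?thesis
      by (auto intro!: derivative_eq_intros simp: field_simps)
  qed
  obtain z where z: "0 < z" "z < 1" "?\<phi> 1 - ?\<phi> 0 = (1 - 0) * ?\<phi>' z"
    using MVT2[of 0 1 ?\<phi> ?\<phi>'] deriv by auto
  have "?\<phi>' z = (g (x + z *\<^sub>R d) - g x - H x *v (z *\<^sub>R d)) \<bullet> d"
    by (simp add: inner_diff_left inner_diff_right matrix_vector_mult_scaleR inner_commute)
  also have "\<bar>\<dots>\<bar> \<le> norm (g (x + z *\<^sub>R d) - g x - H x *v (z *\<^sub>R d)) * norm d"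
    by (rule Cauchy_Schwarz_ineq2)
  also have "\<dots> \<le> L * (norm (z *\<^sub>R d))\<^sup>2 * norm d"
    by (intro mult_right_mono gradient_taylor) simp
  also have "\<dots> \<le> L * (norm d)\<^sup>2 * norm d"
    using z L_nonneg by (intro mult_right_mono mult_left_mono power_mono) (auto simp: mult_left_le_one_le)
  finally show ?thesis
    using z(3) by (simp add: power2_eq_square power3_eq_cube algebra_simps)
qed

text \<open>Subtract the expansions in direction \<open>v\<close> at \<open>x + u\<close> and at
  \<open>x\<close>, then linearize the gradient difference and compare the two quadratic terms. Each
  of the four errors is at most \<open>L * ?N ^ 3\<close>.\<close>

lemma second_difference:
  "\<bar>f (x + u + v) - f (x + u) - f (x + v) + f x - v \<bullet> (H x *v u)\<bar>
     \<le> 4 * L * (norm u + norm v) ^ 3"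
proof -
  let ?N = "norm u + norm v"
  have 1: "\<bar>f (x + u + v) - f (x + u) - g (x + u) \<bullet> v - v \<bullet> (H (x + u) *v v) / 2\<bar> \<le> L * ?N ^ 3"
    using function_taylor[of "x + u" v] L_nonneg
    by (meson add_increasing le_cases mult_left_mono norm_ge_zero order_trans power_mono add_increasing)
  have 2: "\<bar>f (x + v) - f x - g x \<bullet> v - v \<bullet> (H x *v v) / 2\<bar> \<le> L * ?N ^ 3"
    using function_taylor[of x v] L_nonneg
    by (meson add_increasing le_cases mult_left_mono norm_ge_zero order_trans power_mono add_increasing)
  have "\<bar>(g (x + u) - g x - H x *v u) \<bullet> v\<bar> \<le> norm (g (x + u) - g x - H x *v u) * norm v"
    by (rule Cauchy_Schwarz_ineq2)
  also have "\<dots> \<le> L * ?N\<^sup>2 * ?N"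
    using gradient_taylor[of x u] L_nonneg
    by (intro mult_mono order_trans[OF gradient_taylor] mult_left_mono power_mono) auto
  finally have 3: "\<bar>(g (x + u) - g x - H x *v u) \<bullet> v\<bar> \<le> L * ?N ^ 3"
    by (simp add: power2_eq_square power3_eq_cube)
  have "\<bar>v \<bullet> (H (x + u) *v v - H x *v v)\<bar> \<le> norm v * norm (H (x + u) *v v - H x *v v)"
    by (rule Cauchy_Schwarz_ineq2)
  also have "\<dots> \<le> ?N * (L * ?N * ?N)"
  proof (intro mult_mono)
    have "norm (H (x + u) *v v - H x *v v) \<le> L * norm u * norm v"
      using hessian_lipschitz[of "x + u" v x] by simp
    also have "\<dots> \<le> L * ?N * ?N" using L_nonneg by (intro mult_mono) auto
    finally show "norm (H (x + u) *v v - H x *v v) \<le> L * ?N * ?N" .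
  qed auto
  finally have 4: "\<bar>v \<bullet> (H (x + u) *v v - H x *v v)\<bar> \<le> L * ?N ^ 3"
    by (simp add: power3_eq_cube mult.left_commute mult.assoc)
  show ?thesis
    using 1 2 3 4
    by (simp add: inner_diff_left inner_diff_right inner_commute[of "H x *v u"] inner_commute[of "g _"])
qed

text \<open>The second difference is symmetric in its two directions.\<close>
lemma hessian_symmetric: "u \<bullet> (H x *v v) = v \<bullet> (H x *v u)"
proof -
  let ?N = "norm u + norm v"
  let ?b = "\<bar>u \<bullet> (H x *v v) - v \<bullet> (H x *v u)\<bar>"
  \<comment> \<open>Scaling both directions by \<open>t\<close> gives \<open>t^2\<close> in the
    bilinear terms and \<open>t^3\<close> in the error. Exchanging \<open>u\<close> and
    \<open>v\<close> keeps the second difference, so its error counts twice.\<close>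
  have "?b \<le> 0 + (8 * L * ?N ^ 3) * t" if t: "0 < t" for t
  proof -
    let ?u = "t *\<^sub>R u" and ?v = "t *\<^sub>R v"
    have "\<bar>?u \<bullet> (H x *v ?v) - ?v \<bullet> (H x *v ?u)\<bar> \<le> 8 * L * (norm ?u + norm ?v) ^ 3"
      using second_difference[of x ?u ?v] second_difference[of x ?v ?u]
      by (simp add: ac_simps)
    moreover have "?u \<bullet> (H x *v ?v) - ?v \<bullet> (H x *v ?u)
        = t\<^sup>2 * (u \<bullet> (H x *v v) - v \<bullet> (H x *v u))"
      by (simp add: matrix_vector_mult_scaleR power2_eq_square algebra_simps)
    moreover have "norm ?u + norm ?v = t * ?N"
      using t by (simp add: distrib_left)
    ultimately have "t\<^sup>2 * ?b \<le> t\<^sup>2 * (8 * L * ?N ^ 3 * t)"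
      by (simp add: abs_mult power_mult_distrib power2_eq_square power3_eq_cube ac_simps)
    then show ?thesis using t by simp
  qed
  from le_of_le_add_small[OF this] show ?thesis by simp
qed

text \<open>Strong convexity is compared with the Taylor expansion along
  \<open>t *\<^sub>R v\<close>; divide by \<open>t^2\<close> and let \<open>t\<close> tend to
  0.\<close>

lemma hessian_lower_bound:
  assumes "strongly_convex \<mu> f g"
  shows "\<mu> * (norm v)\<^sup>2 \<le> v \<bullet> (H x *v v)"
proof (rule le_of_le_add_small)
  fix t :: real assume t: "0 < t"
  let ?d = "t *\<^sub>R v"
  have "f (x + ?d) \<ge> f x + g x \<bullet> ?d + \<mu> / 2 * (norm ?d)\<^sup>2"
    using assms unfolding strongly_convex_def by (metis add_diff_cancel_left')
  then have "\<mu> / 2 * (norm ?d)\<^sup>2 \<le> ?d \<bullet> (H x *v ?d) / 2 + L * norm ?d ^ 3"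
    using function_taylor[of x ?d] by linarith
  then have "t\<^sup>2 * (\<mu> * (norm v)\<^sup>2) \<le> t\<^sup>2 * (v \<bullet> (H x *v v) + 2 * L * norm v ^ 3 * t)"
    using t by (simp add: matrix_vector_mult_scaleR power_mult_distrib power2_eq_square
        power3_eq_cube algebra_simps)
  then show "\<mu> * (norm v)\<^sup>2 \<le> v \<bullet> (H x *v v) + 2 * L * norm v ^ 3 * t"
    using t by simp
qed

end

subsection \<open>Steps of the outer iteration\<close>

text \<open>The first bound is \<open>cr_descent\<close> with
  \<open>cr_alpha A g 0 \<ge> \<mu> / M\<^sup>2\<close>. The second combines
  \<open>A *v s = - g - r\<close>, where \<open>r\<close> is no longer than \<open>g\<close>, with
  \<open>\<mu> * norm s \<le> norm (A *v s)\<close>.\<close>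

lemma cr_step_bounds:
  fixes A :: "real^'n^'n"
  assumes "spd_matrix A" and \<mu>: "0 < \<mu>" "\<And>v. \<mu> * (norm v)\<^sup>2 \<le> v \<bullet> (A *v v)"
    and M: "0 < M" "\<And>v. norm (A *v v) \<le> M * norm v" and t: "1 \<le> t"
  shows "\<mu> / M\<^sup>2 * (norm g)\<^sup>2 \<le> - (g \<bullet> cr_s A g t)"
    and "norm (cr_s A g t) \<le> 2 / \<mu> * norm g"
proof -
  interpret spd_matrix A by fact
  show "\<mu> / M\<^sup>2 * (norm g)\<^sup>2 \<le> - (g \<bullet> cr_s A g t)"
  proof (cases "g = 0")
    case False
    have "A *v g \<noteq> 0" using False by (simp add: mat_vec_eq_0_iff)
    moreover have "(norm (A *v g))\<^sup>2 \<le> M\<^sup>2 * (norm g)\<^sup>2"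
      using M(2)[of g] by (metis norm_ge_zero power_mono power_mult_distrib)
    then have "\<mu> / M\<^sup>2 * (norm (A *v g))\<^sup>2 \<le> \<mu> / M\<^sup>2 * (M\<^sup>2 * (norm g)\<^sup>2)"
      using \<mu>(1) by (intro mult_left_mono) auto
    with \<mu>(2)[of g] have "\<mu> / M\<^sup>2 * (norm (A *v g))\<^sup>2 \<le> g \<bullet> (A *v g)"
      using M(1) by simp
    moreover have "A *v (- g) = - (A *v g)"
      using matrix_vector_mult_scaleR[of A "- 1" g] by simp
    ultimately have "\<mu> / M\<^sup>2 \<le> cr_alpha A g 0"
      by (simp add: cr_alpha_def pos_le_divide_eq)
    then have "\<mu> / M\<^sup>2 * (norm g)\<^sup>2 \<le> cr_alpha A g 0 * (norm g)\<^sup>2"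
      by (rule mult_right_mono) simp
    also have "\<dots> \<le> - (g \<bullet> cr_s A g t)"
      using cr_descent[OF t, of g] by simp
    finally show ?thesis .
  qed simp
  show "norm (cr_s A g t) \<le> 2 / \<mu> * norm g"
  proof -
    let ?s = "cr_s A g t"
    have "A *v ?s = - g - cr_r A g t" by (simp add: cr_residual)
    then have "norm (A *v ?s) \<le> norm g + norm (cr_r A g t)"
      by (metis norm_minus_cancel norm_triangle_ineq4)
    then have As: "norm (A *v ?s) \<le> 2 * norm g"
      using norm_cr_r_le[of g t] by linarith
    have "\<mu> * (norm ?s)\<^sup>2 \<le> norm ?s * norm (A *v ?s)"
      using \<mu>(2)[of ?s] norm_cauchy_schwarz[of ?s "A *v ?s"] by linarith
    also have "\<dots> \<le> norm ?s * (2 * norm g)"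
      using As by (intro mult_left_mono) auto
    finally have "norm ?s * (\<mu> * norm ?s) \<le> norm ?s * (2 * norm g)"
      by (simp add: power2_eq_square ac_simps)
    then have "\<mu> * norm ?s \<le> 2 * norm g"
      by (cases "?s = 0") simp_all
    then show ?thesis using \<mu>(1) by (simp add: field_simps)
  qed
qed

context lipschitz_hessian_fun
begin

text \<open>The Taylor remainder is quadratic in \<open>\<eta>\<close>, the guaranteed descent
  linear, both in units of the squared gradient norm; \<open>G\<close> absorbs the extra gradient
  factor of the cubic term.\<close>

lemma sufficient_short_step:
  assumes descent: "a * (norm (g x))\<^sup>2 \<le> - (g x \<bullet> s)"
    and size: "norm s \<le> b * norm (g x)" and "0 \<le> b"
    and M: "\<And>v. norm (H x *v v) \<le> M * norm v" "0 \<le> M"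
    and G: "norm (g x) \<le> G"
    and \<eta>: "0 \<le> \<eta>" "\<eta> \<le> 1" "\<eta> * (M * b\<^sup>2 + L * b ^ 3 * G) \<le> (1 - \<rho>) * a"
    and "\<rho> < 1"
  shows "sufficient f x (g x) \<rho> (\<eta> *\<^sub>R s)"
proof -
  let ?n = "norm (g x)"
  have "s \<bullet> (H x *v s) \<le> norm s * (M * norm s)"
    using norm_cauchy_schwarz[of s "H x *v s"] M(1)[of s]
    by (meson mult_left_mono norm_ge_zero order_trans)
  also have "\<dots> \<le> (b * ?n) * (M * (b * ?n))"
    using size assms(3) M(2) by (intro mult_mono) auto
  finally have q: "s \<bullet> (H x *v s) \<le> M * b\<^sup>2 * ?n\<^sup>2"
    by (simp add: power2_eq_square ac_simps)
  have "norm s ^ 3 \<le> (b * ?n) ^ 3" using size by (intro power_mono) auto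
  also have "\<dots> = b ^ 3 * (?n\<^sup>2 * ?n)" by (simp add: power_mult_distrib power2_eq_square power3_eq_cube)
  also have "\<dots> \<le> b ^ 3 * (?n\<^sup>2 * G)" using G assms(3) by (intro mult_left_mono) auto
  finally have c: "L * norm s ^ 3 \<le> L * b ^ 3 * G * ?n\<^sup>2"
    using L_nonneg by (metis mult_left_mono mult.assoc mult.commute)
  have "0 \<le> L * norm s ^ 3" using L_nonneg by simp
  then have c0: "0 \<le> L * b ^ 3 * G * ?n\<^sup>2" using c by linarith
  have "f (x + \<eta> *\<^sub>R s) - f x - \<eta> * (g x \<bullet> s)
      \<le> \<eta>\<^sup>2 * (s \<bullet> (H x *v s)) / 2 + L * norm (\<eta> *\<^sub>R s) ^ 3"
    using function_taylor[of x "\<eta> *\<^sub>R s"]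
    by (simp add: matrix_vector_mult_scaleR power2_eq_square mult.assoc)
  also have "\<dots> \<le> \<eta>\<^sup>2 * (M * b\<^sup>2 * ?n\<^sup>2) + \<eta>\<^sup>2 * (L * b ^ 3 * G * ?n\<^sup>2)"
  proof (rule add_mono)
    have "\<eta>\<^sup>2 * (s \<bullet> (H x *v s)) \<le> \<eta>\<^sup>2 * (M * b\<^sup>2 * ?n\<^sup>2)" using q by (rule mult_left_mono) simp
    moreover have "0 \<le> \<eta>\<^sup>2 * (M * b\<^sup>2 * ?n\<^sup>2)" using M(2) by simp
    ultimately show "\<eta>\<^sup>2 * (s \<bullet> (H x *v s)) / 2 \<le> \<eta>\<^sup>2 * (M * b\<^sup>2 * ?n\<^sup>2)" by linarith
    have "L * norm (\<eta> *\<^sub>R s) ^ 3 = \<eta> ^ 3 * (L * norm s ^ 3)"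
      using \<eta>(1) by (simp add: power_mult_distrib)
    also have "\<dots> \<le> \<eta>\<^sup>2 * (L * b ^ 3 * G * ?n\<^sup>2)"
      by (rule mult_mono[OF power_decreasing c]) (use \<eta>(1,2) L_nonneg in auto)
    finally show "L * norm (\<eta> *\<^sub>R s) ^ 3 \<le> \<eta>\<^sup>2 * (L * b ^ 3 * G * ?n\<^sup>2)" .
  qed
  also have "\<dots> = \<eta> * ?n\<^sup>2 * (\<eta> * (M * b\<^sup>2 + L * b ^ 3 * G))"
    by (simp add: power2_eq_square algebra_simps)
  also have "\<dots> \<le> \<eta> * ?n\<^sup>2 * ((1 - \<rho>) * a)"
    using \<eta> by (intro mult_left_mono) auto
  also have "\<dots> = \<eta> * (1 - \<rho>) * (a * ?n\<^sup>2)" by simp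
  also have "\<dots> \<le> \<eta> * (1 - \<rho>) * (- (g x \<bullet> s))"
    using descent \<eta>(1) \<open>\<rho> < 1\<close> by (intro mult_left_mono) auto
  finally show ?thesis
    by (simp add: sufficient_def algebra_simps)
qed

text \<open>Substituting the residual for \<open>H x *v s\<close> leaves half of
  \<open>g x \<bullet> s\<close> as model decrease. The surplus over \<open>\<rho>\<close>, where
  \<open>\<rho> < 1 / 2\<close> enters, dominates the remaining terms, which are cubic in the
  gradient norm.\<close>

lemma sufficient_newton_like_step:
  assumes descent: "a * (norm (g x))\<^sup>2 \<le> - (g x \<bullet> s)"
    and size: "norm s \<le> b * norm (g x)" and "0 \<le> b"
    and residual: "norm (- g x - H x *v s) \<le> (norm (g x))\<^sup>2"
    and small: "norm (g x) * (b + L * b ^ 3) \<le> (1 / 2 - \<rho>) * a"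
    and "\<rho> < 1 / 2"
  shows "sufficient f x (g x) \<rho> s"
proof -
  let ?n = "norm (g x)" and ?r = "- g x - H x *v s"
  have "- (?r \<bullet> s) \<le> norm ?r * norm s"
    using Cauchy_Schwarz_ineq2[of ?r s] by linarith
  also have "\<dots> \<le> ?n\<^sup>2 * (b * ?n)"
    using residual size by (intro mult_mono) auto
  finally have r: "- (?r \<bullet> s) \<le> b * ?n ^ 3"
    by (simp add: power2_eq_square power3_eq_cube ac_simps)
  have "norm s ^ 3 \<le> (b * ?n) ^ 3" using size by (intro power_mono) auto
  then have c: "L * norm s ^ 3 \<le> L * b ^ 3 * ?n ^ 3"
    using L_nonneg by (metis mult_left_mono mult.assoc power_mult_distrib)
  have "s \<bullet> (H x *v s) = - (g x \<bullet> s) - ?r \<bullet> s"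
    by (simp add: inner_diff_left inner_diff_right inner_commute)
  moreover have "(1 / 2 - \<rho>) * (g x \<bullet> s) = g x \<bullet> s / 2 - \<rho> * (g x \<bullet> s)"
    by (simp add: left_diff_distrib)
  ultimately have "f (x + s) - f x - \<rho> * (g x \<bullet> s)
      \<le> (1 / 2 - \<rho>) * (g x \<bullet> s) - (?r \<bullet> s) / 2 + L * norm s ^ 3"
    using function_taylor[of x s] by linarith
  also have "\<dots> \<le> (1 / 2 - \<rho>) * - (a * ?n\<^sup>2) + b * ?n ^ 3 + L * b ^ 3 * ?n ^ 3"
  proof (intro add_mono c)
    have "(1 / 2 - \<rho>) * (g x \<bullet> s) \<le> (1 / 2 - \<rho>) * - (a * ?n\<^sup>2)"
      using descent \<open>\<rho> < 1 / 2\<close> by (intro mult_left_mono) auto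
    moreover have "0 \<le> b * ?n ^ 3" using \<open>0 \<le> b\<close> by simp
    ultimately show "(1 / 2 - \<rho>) * (g x \<bullet> s) - (?r \<bullet> s) / 2
        \<le> (1 / 2 - \<rho>) * - (a * ?n\<^sup>2) + b * ?n ^ 3"
      using r by linarith
  qed
  also have "\<dots> = ?n\<^sup>2 * (?n * (b + L * b ^ 3) - (1 / 2 - \<rho>) * a)"
    by (simp add: power2_eq_square power3_eq_cube algebra_simps)
  also have "\<dots> \<le> 0" using small by (intro mult_nonneg_nonpos) auto
  finally show ?thesis by (simp add: sufficient_def)
qed

text \<open>The new gradient is the Taylor error minus the residual, and both are quadratic in the
  old gradient.\<close>

lemma gradient_after_newton_like_step:
  assumes size: "norm s \<le> b * norm (g x)"
    and residual: "norm (- g x - H x *v s) \<le> (norm (g x))\<^sup>2"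
  shows "norm (g (x + s)) \<le> (1 + L * b\<^sup>2) * (norm (g x))\<^sup>2"
proof -
  have "norm (g (x + s)) \<le> norm (g (x + s) - g x - H x *v s) + norm (- g x - H x *v s)"
    using norm_triangle_ineq4[of "g (x + s) - g x - H x *v s" "- g x - H x *v s"] by simp
  also have "\<dots> \<le> L * (b * norm (g x))\<^sup>2 + (norm (g x))\<^sup>2"
    using L_nonneg size residual
    by (intro add_mono order_trans[OF gradient_taylor] mult_left_mono power_mono) auto
  finally show ?thesis by (simp add: power_mult_distrib algebra_simps)
qed

end

text \<open>If the accepted exponent is positive, the preceding trial was rejected and hence exceeds
  \<open>\<eta>0\<close>; one factor \<open>\<zeta>\<close> is lost.\<close>

lemma backtracking_step:
  assumes "0 < \<zeta>" "\<zeta> < 1" "0 < \<eta>0" "\<eta>0 \<le> 1"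
    and short: "\<And>\<eta>. 0 < \<eta> \<Longrightarrow> \<eta> \<le> \<eta>0 \<Longrightarrow> sufficient f x gx \<rho> (\<eta> *\<^sub>R s)"
  obtains \<eta> where "\<zeta> * \<eta>0 \<le> \<eta>" "backtracking f x gx \<rho> \<zeta> s = \<eta> *\<^sub>R s"
    "sufficient f x gx \<rho> (\<eta> *\<^sub>R s)"
proof -
  define j where "j = (LEAST j. sufficient f x gx \<rho> (\<zeta> ^ j *\<^sub>R s))"
  \<comment> \<open>Some trial length is acceptable, so \<open>LEAST\<close> is attained.\<close>
  obtain n where "\<zeta> ^ n < \<eta>0"
    using real_arch_pow_inv assms(2,3) by blast
  then have "sufficient f x gx \<rho> (\<zeta> ^ n *\<^sub>R s)"
    using assms(1) by (intro short) auto
  then have "sufficient f x gx \<rho> (\<zeta> ^ j *\<^sub>R s)"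
    unfolding j_def by (rule LeastI)
  moreover have "\<zeta> * \<eta>0 \<le> \<zeta> ^ j"
  proof (cases j)
    case 0
    then show ?thesis using assms by (simp add: mult_le_one)
  next
    case (Suc m)
    then have "\<not> sufficient f x gx \<rho> (\<zeta> ^ m *\<^sub>R s)"
      unfolding j_def by (metis lessI not_less_Least)
    then have "\<eta>0 < \<zeta> ^ m" using short[of "\<zeta> ^ m"] assms(1) by fastforce
    then show ?thesis using assms(1) Suc by simp
  qed
  ultimately show thesis using that[of "\<zeta> ^ j"] by (simp add: backtracking_def j_def)
qed

lemma backtracking_full_step:
  assumes "sufficient f x gx \<rho> s"
  shows "backtracking f x gx \<rho> \<zeta> s = s"
proof -
  have "(LEAST j. sufficient f x gx \<rho> (\<zeta> ^ j *\<^sub>R s)) = 0"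
    using assms by (intro Least_eq_0) simp
  then show ?thesis by (simp add: backtracking_def)
qed

text \<open>The Polyak-Lojasiewicz inequality, by completing the square in
  \<open>norm (y - x)\<close>.\<close>

lemma gap_le_gradient:
  assumes "strongly_convex \<mu> f g" "0 < \<mu>"
  shows "2 * \<mu> * (f x - f y) \<le> (norm (g x))\<^sup>2"
proof -
  let ?d = "y - x"
  have "f x - f y \<le> - (g x \<bullet> ?d) - \<mu> / 2 * (norm ?d)\<^sup>2"
    using assms(1) unfolding strongly_convex_def by (smt (verit))
  also have "\<dots> \<le> norm (g x) * norm ?d - \<mu> / 2 * (norm ?d)\<^sup>2"
    using Cauchy_Schwarz_ineq2[of "g x" ?d] by linarith
  finally have "2 * \<mu> * (f x - f y) \<le> 2 * \<mu> * (norm (g x) * norm ?d - \<mu> / 2 * (norm ?d)\<^sup>2)"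
    using assms(2) by simp
  also have "\<dots> = (norm (g x))\<^sup>2 - (norm (g x) - \<mu> * norm ?d)\<^sup>2"
    by (simp add: power2_eq_square algebra_simps)
  also have "\<dots> \<le> (norm (g x))\<^sup>2" by simp
  finally show ?thesis .
qed

lemma sublevel_subset_cball:
  assumes "strongly_convex \<mu> f g" "0 < \<mu>" "f y \<le> f x"
  shows "y \<in> cball x (2 * norm (g x) / \<mu>)"
proof -
  let ?d = "y - x"
  have "\<mu> / 2 * (norm ?d)\<^sup>2 \<le> - (g x \<bullet> ?d)"
    using assms(1,3) unfolding strongly_convex_def by (smt (verit))
  also have "\<dots> \<le> norm (g x) * norm ?d"
    using Cauchy_Schwarz_ineq2[of "g x" ?d] by linarith
  finally have "norm ?d * (\<mu> * norm ?d) \<le> norm ?d * (2 * norm (g x))"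
    by (simp add: power2_eq_square ac_simps)
  then have "\<mu> * norm ?d \<le> 2 * norm (g x)"
    by (cases "?d = 0") simp_all
  then show ?thesis
    using assms(2) by (simp add: dist_norm norm_minus_commute field_simps)
qed

text \<open>All points with value at most \<open>f 0\<close> lie in the compact ball, so the minimum
  over the ball is global.\<close>

lemma strongly_convex_minimizer:
  assumes "strongly_convex \<mu> f g" "0 < \<mu>" "continuous_on UNIV f"
  obtains xmin where "\<And>y. f xmin \<le> f y"
proof -
  let ?B = "cball (0::real^'a) (2 * norm (g 0) / \<mu>)"
  have "0 \<in> ?B" using assms(2) by simp
  have "\<exists>z\<in>?B. \<forall>y\<in>?B. f z \<le> f y"
  proof (rule continuous_attains_inf)
    show "?B \<noteq> {}" using \<open>0 \<in> ?B\<close> by force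
    show "continuous_on ?B f" using assms(3) by (rule continuous_on_subset) simp
  qed simp
  then obtain xmin where min: "\<forall>y\<in>?B. f xmin \<le> f y" by force
  have "f xmin \<le> f y" for y
    using sublevel_subset_cball[OF assms(1,2), of y 0] min \<open>0 \<in> ?B\<close>
    by (metis linorder_le_cases order_trans)
  then show thesis using that by blast
qed

text \<open>The factor \<open>C * \<delta> k\<close> in front of \<open>\<delta> k\<close> tends to
  0.\<close>

lemma converges_superlinearly_quadratic:
  assumes nonneg: "\<And>k. 0 \<le> \<delta> k" and lim: "\<delta> \<longlonglongrightarrow> 0"
    and quad: "\<forall>\<^sub>F k in sequentially. \<delta> (Suc k) \<le> C * (\<delta> k)\<^sup>2"
  shows "converges_superlinearly \<delta>"
  unfolding converges_superlinearly_def
proof (intro conjI lim landau_o.smallI)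
  fix c :: real assume "0 < c"
  have "(\<lambda>k. C * \<delta> k) \<longlonglongrightarrow> C * 0" by (intro tendsto_intros lim)
  then have "\<forall>\<^sub>F k in sequentially. C * \<delta> k < c"
    using \<open>0 < c\<close> by (intro order_tendstoD) auto
  then show "\<forall>\<^sub>F k in sequentially. norm (\<delta> (Suc k)) \<le> c * norm (\<delta> k)"
    using quad
  proof eventually_elim
    case (elim k)
    have "(C * \<delta> k) * \<delta> k \<le> c * \<delta> k" using elim(1) nonneg by (intro mult_right_mono) auto
    then show ?case using elim(2) nonneg by (simp add: power2_eq_square mult.assoc)
  qed
qed

subsection \<open>Superlinear convergence\<close>

(* Since the inner solver requires T \<le> Tmax \<le> d, the lower bound on T is capped at d:
   without the cap no T is admissible once the gradient is small.  Whenever the bound is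
   at most d, the cap has no effect; otherwise T = Tmax = d. *)
theorem corollary2:
  fixes f :: "real^'n \<Rightarrow> real"
    and g :: "real^'n \<Rightarrow> real^'n"
    and H :: "real^'n \<Rightarrow> real^'n^'n"
    and x :: "nat \<Rightarrow> real^'n"
    and x0 :: "real^'n"
    and \<mu> L H0 \<kappa> \<rho> \<zeta> :: real
    and \<omega> :: "nat \<Rightarrow> real"
    and T Tmax :: "nat \<Rightarrow> nat"
  assumes smooth: "twice_cont_differentiable f g H"
    and mu: "\<mu> > 0"
    and convex: "strongly_convex \<mu> f g"
    and lipschitz: "lipschitz_hessian L H"
    and H0: "H0 > 0"
    and hessian_bound: "\<And>y. f y \<le> f x0 \<Longrightarrow> spectral_norm (H y) \<le> H0"
    and kappa: "\<kappa> = H0 / \<mu>"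
    and rho: "0 < \<rho>" "\<rho> < 1/2"
    and zeta: "0 < \<zeta>" "\<zeta> < 1"
    and run: "fncr_ls_run f g H \<rho> \<zeta> \<omega> T Tmax x0 x"
    and inner_T: "\<And>k. g (x k) \<noteq> 0 \<Longrightarrow> 1 \<le> T k \<and> T k \<le> Tmax k \<and> Tmax k \<le> CARD('n)"
    and inner_omega: "\<And>k. g (x k) \<noteq> 0 \<Longrightarrow> 0 \<le> \<omega> k \<and> \<omega> k < 1 \<and> \<omega> k \<le> norm (g (x k))"
    and T_bound: "\<And>k. g (x k) \<noteq> 0 \<Longrightarrow>
      int (T k) \<ge> min \<lceil>sqrt \<kappa> * ln (2 * inverse (norm (g (x k)))) / 4\<rceil> (int CARD('n))"
  shows "\<exists>xmin. (\<forall>y. f xmin \<le> f y) \<and> converges_superlinearly (\<lambda>k. f (x k) - f xmin)"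
proof -
  interpret lipschitz_hessian_fun f g H L
    using smooth lipschitz by unfold_locales
  have f_cont: "continuous_on UNIV f" and g_cont: "continuous_on UNIV g"
    using smooth
    by (auto simp: twice_cont_differentiable_def gderiv_def continuous_on_eq_continuous_at
        dest: has_derivative_continuous)
  obtain xmin where xmin: "\<And>y. f xmin \<le> f y"
    using strongly_convex_minimizer[OF convex mu f_cont] by blast
  define \<delta> where "\<delta> k = f (x k) - f xmin" for k
  have \<delta>_nonneg: "0 \<le> \<delta> k" for k using xmin by (simp add: \<delta>_def)
  have gap: "2 * \<mu> * \<delta> k \<le> (norm (g (x k)))\<^sup>2" for k
    unfolding \<delta>_def by (rule gap_le_gradient[OF convex mu])

  \<comment> \<open>Uniform bounds on the initial sublevel set\<close>
  have "compact (g ` cball x0 (2 * norm (g x0) / \<mu>))"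
    by (intro compact_continuous_image continuous_on_subset[OF g_cont]) auto
  then obtain G where G: "0 < G" "\<And>y. f y \<le> f x0 \<Longrightarrow> norm (g y) \<le> G"
    using compact_imp_bounded sublevel_subset_cball[OF convex mu]
    by (metis bounded_pos image_eqI)

  define a where "a = \<mu> / H0\<^sup>2"
  define b where "b = 2 / \<mu>"
  have a: "0 < a" and b: "0 < b" using mu H0 by (simp_all add: a_def b_def)
  have spd: "spd_matrix (H y)" for y
  proof
    show "u \<bullet> (H y *v v) = v \<bullet> (H y *v u)" for u v by (rule hessian_symmetric)
    show "0 < v \<bullet> (H y *v v)" if "v \<noteq> 0" for v
      using hessian_lower_bound[OF convex, of v y] mu that
      by (smt (verit) mult_pos_pos zero_less_norm_iff zero_less_power)
  qed
  have hessian_upper: "norm (H y *v v) \<le> H0 * norm v" if "f y \<le> f x0" for y v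
    using norm_mult_le_spectral[of "H y" v] hessian_bound[OF that]
    by (meson mult_right_mono norm_ge_zero order_trans)

  define s where "s k = inner_solver f (x k) (g (x k)) (H (x k)) \<rho> (\<omega> k) (T k) (Tmax k)" for k
  have x_0: "x 0 = x0"
    and stopped: "g (x k) = 0 \<Longrightarrow> x (Suc k) = x k"
    and step: "g (x k) \<noteq> 0 \<Longrightarrow> x (Suc k) = x k + backtracking f (x k) (g (x k)) \<rho> \<zeta> (s k)" for k
    using run by (simp_all add: fncr_ls_run_def s_def)
  have s_bounds: "a * (norm (g (x k)))\<^sup>2 \<le> - (g (x k) \<bullet> s k)" "norm (s k) \<le> b * norm (g (x k))"
    and s_residual: "T k = CARD('n) \<Longrightarrow> norm (- g (x k) - H (x k) *v s k) \<le> (norm (g (x k)))\<^sup>2"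
    if nz: "g (x k) \<noteq> 0" and le: "f (x k) \<le> f x0" for k
  proof -
    obtain t where t: "1 \<le> t" "s k = cr_s (H (x k)) (g (x k)) t"
      "T k = Tmax k \<longrightarrow> t = Tmax k \<or> norm (cr_r (H (x k)) (g (x k)) t) \<le> \<omega> k * norm (g (x k))"
      using inner_loop_result[of "T k" "Tmax k" "\<omega> k" "g (x k)" 0 f "x k" "H (x k)" \<rho>]
        inner_T[OF nz] inner_omega[OF nz] nz
      unfolding s_def inner_solver_def by auto
    show "a * (norm (g (x k)))\<^sup>2 \<le> - (g (x k) \<bullet> s k)" "norm (s k) \<le> b * norm (g (x k))"
      unfolding a_def b_def t(2)
      using cr_step_bounds[OF spd mu hessian_lower_bound[OF convex] H0 hessian_upper[OF le] t(1)]
      by blast+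
    assume full: "T k = CARD('n)"
    then have "T k = Tmax k" using inner_T[OF nz] by simp
    \<comment> \<open>Either the residual test was passed, or \<open>t = Tmax k = d\<close> and CR
      has terminated with residual 0.\<close>
    with t(3) have "norm (cr_r (H (x k)) (g (x k)) t) \<le> \<omega> k * norm (g (x k))"
      using spd_matrix.cr_terminates[OF spd, of t] full inner_omega[OF nz] by auto
    also have "\<dots> \<le> norm (g (x k)) * norm (g (x k))"
      using inner_omega[OF nz] by (intro mult_right_mono) auto
    finally show "norm (- g (x k) - H (x k) *v s k) \<le> (norm (g (x k)))\<^sup>2"
      by (simp add: cr_residual t(2) power2_eq_square)
  qed

  \<comment> \<open>Uniform decrease and geometric convergence\<close>
  define K where "K = H0 * b\<^sup>2 + L * b ^ 3 * G"
  have K: "0 < K" using H0 b L_nonneg G(1) by (auto simp: K_def intro!: add_pos_nonneg)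
  \<comment> \<open>The largest length up to 1 that \<open>sufficient_short_step\<close> permits
    throughout the sublevel set.\<close>
  define \<eta>0 where "\<eta>0 = min 1 ((1 - \<rho>) * a / K)"
  have \<eta>0: "0 < \<eta>0" "\<eta>0 \<le> 1" using rho a K by (simp_all add: \<eta>0_def)
  define c where "c = \<rho> * (\<zeta> * \<eta>0 * a)"
  have c: "0 < c" using rho zeta \<eta>0 a by (simp add: c_def)
  have decrease: "f (x (Suc k)) \<le> f (x k) - c * (norm (g (x k)))\<^sup>2" if le: "f (x k) \<le> f x0" for k
  proof (cases "g (x k) = 0")
    case False
    have short: "sufficient f (x k) (g (x k)) \<rho> (\<eta> *\<^sub>R s k)" if "0 < \<eta>" "\<eta> \<le> \<eta>0" for \<eta>
    proof (rule sufficient_short_step[OF s_bounds[OF False le] _ hessian_upper[OF le] _ G(2)[OF le]])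
      have "\<eta> \<le> (1 - \<rho>) * a / K" using that by (simp add: \<eta>0_def)
      then show "\<eta> * (H0 * b\<^sup>2 + L * b ^ 3 * G) \<le> (1 - \<rho>) * a"
        using K by (simp add: K_def[symmetric] pos_le_divide_eq)
    qed (use that \<eta>0 b H0 rho in auto)
    obtain \<eta> where \<eta>: "\<zeta> * \<eta>0 \<le> \<eta>"
      "backtracking f (x k) (g (x k)) \<rho> \<zeta> (s k) = \<eta> *\<^sub>R s k"
      "sufficient f (x k) (g (x k)) \<rho> (\<eta> *\<^sub>R s k)"
      by (rule backtracking_step[OF zeta \<eta>0]) (rule short)
    have "0 < \<zeta> * \<eta>0" using zeta(1) \<eta>0(1) by simp
    then have "\<zeta> * \<eta>0 * (a * (norm (g (x k)))\<^sup>2) \<le> \<eta> * - (g (x k) \<bullet> s k)"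
      using \<eta>(1) s_bounds(1)[OF False le] a by (intro mult_mono) auto
    then have "c * (norm (g (x k)))\<^sup>2 \<le> \<rho> * (\<eta> * - (g (x k) \<bullet> s k))"
      unfolding c_def mult.assoc using rho(1) by (intro mult_left_mono) auto
    then show ?thesis
      using \<eta>(2,3) step[OF False] by (simp add: sufficient_def)
  qed (simp add: stopped)
  \<comment> \<open>The bounds behind \<open>decrease\<close> hold only on the initial sublevel set;
    \<open>decrease\<close> itself keeps the next iterate there.\<close>
  have sublevel: "f (x k) \<le> f x0" for k
  proof (induction k)
    case (Suc k)
    moreover have "0 \<le> c * (norm (g (x k)))\<^sup>2" using c by simp
    ultimately show ?case using decrease[of k] by linarith
  qed (simp add: x_0)
  have gap_decrease: "c * (norm (g (x k)))\<^sup>2 \<le> \<delta> k - \<delta> (Suc k)" for k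
    using decrease[OF sublevel, of k] by (simp add: \<delta>_def)

  \<comment> \<open>The contraction factor from \<open>gap\<close> and \<open>gap_decrease\<close>;
    the maximum secures \<open>0 \<le> q\<close>.\<close>
  define q where "q = max 0 (1 - 2 * \<mu> * c)"
  have q: "0 \<le> q" "q < 1" using mu c by (simp_all add: q_def)
  have geometric: "\<delta> k \<le> q ^ k * \<delta> 0" for k
  proof (induction k)
    case (Suc k)
    have "c * (2 * \<mu> * \<delta> k) \<le> \<delta> k - \<delta> (Suc k)"
      using gap_decrease[of k] mult_left_mono[OF gap[of k], of c] c by linarith
    then have "\<delta> (Suc k) \<le> (1 - 2 * \<mu> * c) * \<delta> k" by (simp add: algebra_simps)
    also have "\<dots> \<le> q * \<delta> k" using \<delta>_nonneg by (intro mult_right_mono) (simp_all add: q_def)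
    also have "\<dots> \<le> q * (q ^ k * \<delta> 0)" using Suc q by (intro mult_left_mono)
    finally show ?case by (simp add: mult.assoc)
  qed simp
  have "(\<lambda>k. q ^ k * \<delta> 0) \<longlonglongrightarrow> 0"
    using q by (intro tendsto_mult_left_zero LIMSEQ_realpow_zero)
  then have \<delta>_lim: "\<delta> \<longlonglongrightarrow> 0"
    using tendsto_sandwich[of "\<lambda>_. 0" \<delta> sequentially "\<lambda>k. q ^ k * \<delta> 0" 0]
    by (simp add: \<delta>_nonneg geometric)
  have gradient_le_gap: "(norm (g (x k)))\<^sup>2 \<le> \<delta> k / c" for k
    using gap_decrease[of k] \<delta>_nonneg[of "Suc k"] c
    by (simp add: pos_le_divide_eq mult.commute)
  have gradient_small: "\<forall>\<^sub>F k in sequentially. norm (g (x k)) < e" if "0 < e" for e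
  proof -
    have "\<forall>\<^sub>F k in sequentially. \<delta> k < c * e\<^sup>2"
      using \<delta>_lim c that by (intro order_tendstoD(2)[of \<delta> 0]) auto
    then show ?thesis
    proof eventually_elim
      case (elim k)
      then have "\<delta> k / c < e\<^sup>2" using c by (simp add: pos_divide_less_eq mult.commute)
      with gradient_le_gap[of k] have "(norm (g (x k)))\<^sup>2 < e\<^sup>2" by linarith
      then show ?case using that by (simp add: power2_less_imp_less)
    qed
  qed

  \<comment> \<open>Eventual quadratic decay of the gap\<close>
  define C where "C = 1 + L * b\<^sup>2"
  have C: "0 < C" using L_nonneg by (simp add: C_def add_pos_nonneg)
  have \<kappa>: "0 < \<kappa>" using kappa H0 mu by simp
  \<comment> \<open>Below \<open>e1\<close> the uncapped bound on \<open>T\<close> reaches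
    \<open>d\<close>; below \<open>e2\<close> the smallness condition of
    \<open>sufficient_newton_like_step\<close> holds.\<close>
  define e1 where "e1 = 2 * exp (- (4 * real CARD('n) / sqrt \<kappa>))"
  define e2 where "e2 = (1 / 2 - \<rho>) * a / (b + L * b ^ 3)"
  have b': "0 < b + L * b ^ 3" using b L_nonneg by (simp add: add_pos_nonneg)
  have e: "0 < e1" "0 < e2" using rho a b' by (simp_all add: e1_def e2_def)
  have "\<forall>\<^sub>F k in sequentially. \<delta> (Suc k) \<le> C\<^sup>2 / (2 * \<mu> * c\<^sup>2) * (\<delta> k)\<^sup>2"
    using gradient_small[OF e(1)] gradient_small[OF e(2)]
  proof eventually_elim
    case (elim k)
    show ?case
    proof (cases "g (x k) = 0")
      case True
      then have "\<delta> (Suc k) \<le> 0"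
        using gap[of k] stopped[OF True] mu by (simp add: \<delta>_def mult_le_0_iff)
      also have "0 \<le> C\<^sup>2 / (2 * \<mu> * c\<^sup>2) * (\<delta> k)\<^sup>2" using mu by simp
      finally show ?thesis .
    next
      case False
      let ?n = "norm (g (x k))"
      have n: "0 < ?n" using False by simp
      have "4 * real CARD('n) / sqrt \<kappa> \<le> ln (2 * inverse ?n)"
      proof -
        have "?n * exp (4 * real CARD('n) / sqrt \<kappa>) \<le> 2"
          using elim(1) by (simp add: e1_def exp_minus field_simps)
        then have "exp (4 * real CARD('n) / sqrt \<kappa>) \<le> 2 * inverse ?n"
          using n by (simp add: field_simps)
        then show ?thesis using n by (simp add: ln_ge_iff)
      qed
      then have "real CARD('n) \<le> sqrt \<kappa> * ln (2 * inverse ?n) / 4"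
        using \<kappa> by (simp add: pos_divide_le_eq mult.commute)
      then have "int CARD('n) \<le> \<lceil>sqrt \<kappa> * ln (2 * inverse ?n) / 4\<rceil>"
        by linarith
      then have "T k = CARD('n)"
        using T_bound[OF False] inner_T[OF False] by linarith
      note residual = s_residual[OF False sublevel this]
      note bounds = s_bounds[OF False sublevel]
      have "?n * (b + L * b ^ 3) \<le> (1 / 2 - \<rho>) * a"
        using elim(2) b' by (simp add: e2_def pos_less_divide_eq)
      with bounds residual have "sufficient f (x k) (g (x k)) \<rho> (s k)"
        using b rho(2) by (intro sufficient_newton_like_step[of a _ _ b]) auto
      then have "x (Suc k) = x k + s k"
        using step[OF False] by (simp add: backtracking_full_step)
      then have "norm (g (x (Suc k))) \<le> C * ?n\<^sup>2"
        using gradient_after_newton_like_step[OF bounds(2) residual] by (simp add: C_def)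
      also have "\<dots> \<le> C * (\<delta> k / c)"
        using C gradient_le_gap by (intro mult_left_mono) auto
      finally have "(norm (g (x (Suc k))))\<^sup>2 \<le> (C * (\<delta> k / c))\<^sup>2"
        by (intro power_mono) auto
      \<comment> \<open>The gap is bounded by the squared gradient, and the new gradient is already
        linear in the old gap.\<close>
      then have "2 * \<mu> * \<delta> (Suc k) \<le> (C * (\<delta> k / c))\<^sup>2"
        using gap[of "Suc k"] by linarith
      then show ?thesis using mu c by (simp add: field_simps power_mult_distrib power_divide)
    qed
  qed
  then have "converges_superlinearly \<delta>"
    by (rule converges_superlinearly_quadratic[OF \<delta>_nonneg \<delta>_lim])
  then show ?thesis using xmin unfolding \<delta>_def by blast
qed

end
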